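(* Let $\Psi\in\mathcal B_0$ be positive and satisfy the weak lower scaling property with $\underline\theta=0$, i.e. there exist $\underline\mu>0$ and $\underline c\in(0,1]$ such that $\Psi(\gamma u)\ge\underline c\,\gamma^{\underline\mu}\Psi(u)$ for all $u>0$, $\gamma\ge1$. Then there are no bounded $\Psi$-harmonic functions on $\mathbb R^d$ other than constants.
   Context: $\mathcal B_0$ is the set of Bernstein functions $\Psi\in C^\infty((0,\infty))$ with $\Psi\ge0$, $(-1)^n\Psi^{(n)}\le0$ for all integers $n\ge1$, and $\lim_{u\downarrow0}\Psi(u)=0$. $(X_t)_{t\ge0}$ is the subordinate Brownian motion $X_t=B_{S_t}$ in $\mathbb R^d$, where $B$ is $d$-dimensional Brownian motion with $\mathbb E[e^{i\xi\cdot B_t}]=e^{-t|\xi|^2}$ and $S$ is an independent subordinator with $\mathbb E[e^{-uS_t}]=e^{-t\Psi(u)}$; $X$ is a Lévy process with generator $-\Psi(-\Delta)$. $\mathbb E^x$ refers to $X$ started at $x$. $\tau_{\mathcal D}=\inf\{t>0: X_t\notin\mathcal D\}$. A (measurable) function $\varphi$ on $\mathbb R^d$ is $\Psi$-harmonic if for every bounded domain $\mathcal D\subset\mathbb R^d$ and every $t>0$, $\varphi(x)=\mathbb E^x[\varphi(X_{t\wedge\tau_{\mathcal D}})]$ for all $x\in\mathcal D$. *)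

theory Defs
  imports "HOL-Probability.Probability"
begin

definition bernstein_class_0 :: "(real \<Rightarrow> real) \<Rightarrow> bool" where
  "bernstein_class_0 \<Psi> \<longleftrightarrow>
     (\<forall>n. \<forall>u>0. (deriv ^^ n) \<Psi> differentiable (at u)) \<and>
     (\<forall>u>0. \<Psi> u \<ge> 0) \<and>
     (\<forall>n\<ge>1. \<forall>u>0. (-1) ^ n * (deriv ^^ n) \<Psi> u \<le> 0) \<and>
     (\<Psi> \<longlongrightarrow> 0) (at_right 0)"

definition weak_lower_scaling :: "(real \<Rightarrow> real) \<Rightarrow> real \<Rightarrow> real \<Rightarrow> real \<Rightarrow> bool" where
  "weak_lower_scaling \<Psi> \<mu> c \<theta> \<longleftrightarrow>
     \<mu> > 0 \<and> c \<in> {0<..1} \<and> (\<forall>u>\<theta>. \<forall>\<gamma>\<ge>1. \<Psi> (\<gamma> * u) \<ge> c * \<gamma> powr \<mu> * \<Psi> u)"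

definition cadlag :: "(real \<Rightarrow> 'b::topological_space) \<Rightarrow> bool" where
  "cadlag f \<longleftrightarrow>
     (\<forall>t\<ge>0. (f \<longlongrightarrow> f t) (at_right t)) \<and> (\<forall>t>0. \<exists>l. (f \<longlongrightarrow> l) (at_left t))"

text \<open>Processes have time set \<open>[0,\<infinity>)\<close>; their values at negative times are irrelevant
  and unconstrained.\<close>

definition levy_process :: "'w measure \<Rightarrow> (real \<Rightarrow> 'w \<Rightarrow> 'b::euclidean_space) \<Rightarrow> bool" where
  "levy_process M X \<longleftrightarrow>
     prob_space M \<and>
     (\<forall>t\<ge>0. X t \<in> borel_measurable M) \<and>
     (AE \<omega> in M. X 0 \<omega> = 0) \<and>
     (\<forall>(t :: nat \<Rightarrow> real) n. 0 \<le> t 0 \<and> mono t \<longrightarrow>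
        prob_space.indep_vars M (\<lambda>_. borel) (\<lambda>i \<omega>. X (t (Suc i)) \<omega> - X (t i) \<omega>) {..<n}) \<and>
     (\<forall>s t. 0 \<le> s \<and> s \<le> t \<longrightarrow>
        distr M borel (\<lambda>\<omega>. X t \<omega> - X s \<omega>) = distr M borel (X (t - s))) \<and>
     (AE \<omega> in M. cadlag (\<lambda>t. X t \<omega>))"

text \<open>The normalisation of Brownian motion is the one with generator \<open>\<Delta>\<close> (not \<open>\<Delta>/2\<close>).\<close>

definition brownian_motion :: "'w measure \<Rightarrow> (real \<Rightarrow> 'w \<Rightarrow> 'b::euclidean_space) \<Rightarrow> bool" where
  "brownian_motion M B \<longleftrightarrow>
     levy_process M B \<and>
     (AE \<omega> in M. continuous_on {0..} (\<lambda>t. B t \<omega>)) \<and>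
     (\<forall>t\<ge>0. \<forall>\<xi>. (CLINT \<omega>|M. iexp (\<xi> \<bullet> B t \<omega>)) = complex_of_real (exp (- t * (norm \<xi>)\<^sup>2)))"

definition subordinator :: "(real \<Rightarrow> real) \<Rightarrow> 'w measure \<Rightarrow> (real \<Rightarrow> 'w \<Rightarrow> real) \<Rightarrow> bool" where
  "subordinator \<Psi> M S \<longleftrightarrow>
     levy_process M S \<and>
     (AE \<omega> in M. mono_on {0..} (\<lambda>t. S t \<omega>)) \<and>
     (\<forall>t\<ge>0. \<forall>u>0. (LINT \<omega>|M. exp (- u * S t \<omega>)) = exp (- t * \<Psi> u))"

definition process_sigma_sets ::
  "'w measure \<Rightarrow> (real \<Rightarrow> 'w \<Rightarrow> 'b::topological_space) \<Rightarrow> 'w set set" where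
  "process_sigma_sets M X =
     sigma_sets (space M) {X t -` A \<inter> space M | t A. t \<ge> 0 \<and> A \<in> sets borel}"

definition independent_processes ::
  "'w measure \<Rightarrow> (real \<Rightarrow> 'w \<Rightarrow> 'b::topological_space) \<Rightarrow> (real \<Rightarrow> 'w \<Rightarrow> 'c::topological_space) \<Rightarrow> bool" where
  "independent_processes M X Y \<longleftrightarrow>
     prob_space.indep_set M (process_sigma_sets M X) (process_sigma_sets M Y)"

text \<open>\<open>X\<close> is the subordinate Brownian motion \<open>B\<^bsub>S\<^esub>\<close>, started at the origin.\<close>

definition subordinate_brownian_motion ::
  "(real \<Rightarrow> real) \<Rightarrow> 'w measure \<Rightarrow> (real \<Rightarrow> 'w \<Rightarrow> 'b::euclidean_space) \<Rightarrow> bool" where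
  "subordinate_brownian_motion \<Psi> M X \<longleftrightarrow>
     (\<exists>B S. brownian_motion M B \<and> subordinator \<Psi> M S \<and> independent_processes M B S \<and>
        X = (\<lambda>t \<omega>. B (S t \<omega>) \<omega>))"

definition exit_time :: "(real \<Rightarrow> 'w \<Rightarrow> 'b) \<Rightarrow> 'b set \<Rightarrow> 'w \<Rightarrow> ereal" where
  "exit_time X D \<omega> = Inf (ereal ` {t. t > 0 \<and> X t \<omega> \<notin> D})"

definition stopped_at_exit :: "(real \<Rightarrow> 'w \<Rightarrow> 'b) \<Rightarrow> 'b set \<Rightarrow> real \<Rightarrow> 'w \<Rightarrow> 'b" where
  "stopped_at_exit X D t \<omega> = X (real_of_ereal (min (ereal t) (exit_time X D \<omega>))) \<omega>"

text \<open>\<open>X\<close> is a Levy process started at \<open>0\<close>, so under \<open>P\<^sup>x\<close> the process has the law of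
  \<open>x + X\<close> under \<open>M\<close>.  The expectation is taken over the completion of \<open>M\<close> since the exit time
  from an open set is in general measurable only for the completed sigma-algebra; it is stated
  with \<open>has_bochner_integral\<close> so that the equation asserts that the expectation exists rather than
  appealing to the default value \<open>0\<close> of the Bochner integral.\<close>

definition process_harmonic ::
  "'w measure \<Rightarrow> (real \<Rightarrow> 'w \<Rightarrow> 'b::euclidean_space) \<Rightarrow> ('b \<Rightarrow> real) \<Rightarrow> bool" where
  "process_harmonic M X \<phi> \<longleftrightarrow>
     \<phi> \<in> borel_measurable borel \<and>
     (\<forall>D t x. open D \<and> connected D \<and> bounded D \<and> t > 0 \<and> x \<in> D \<longrightarrow>
        has_bochner_integral (completion M)
          (\<lambda>\<omega>. \<phi> (stopped_at_exit (\<lambda>s \<omega>. x + X s \<omega>) D t \<omega>)) (\<phi> x))"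

end

theory Submission imports Defs begin

text \<open>Exhausting the space by balls removes the stopping, since the paths are bounded on compact
  time intervals; so \<open>\<phi> x = E \<phi> (x + X\<^sub>t)\<close> for all \<open>t > 0\<close>.  Comparing
  characteristic functions, \<open>X\<^sub>t\<close> has the law of \<open>sqrt (2 * S\<^sub>t) *\<^sub>R Z\<close> with \<open>Z\<close> a standard
  Gaussian independent of \<open>S\<close>.  The laws of \<open>x + r *\<^sub>R Z\<close> and \<open>y + r *\<^sub>R Z\<close> merge in total
  variation as \<open>r\<close> tends to infinity, because translations of the Gaussian density are continuous in
  \<open>L\<^sup>1\<close>.  Finally \<open>E exp (- S\<^sub>t) = exp (- t * \<Psi> 1)\<close> tends to \<open>0\<close>, so \<open>S\<^sub>t\<close> tends to
  infinity in probability and \<open>\<phi> x = \<phi> y\<close>.\<close>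

subsection \<open>The standard Gaussian measure on a Euclidean space\<close>

definition std_gaussian_density :: "'a::euclidean_space \<Rightarrow> real" where
  "std_gaussian_density z = (\<Prod>b\<in>Basis. std_normal_density (z \<bullet> b))"

abbreviation std_gaussian :: "'a::euclidean_space measure" where
  "std_gaussian \<equiv> density lborel (\<lambda>z. ennreal (std_gaussian_density z))"

lemma norm_power2_eq_sum_Basis: "(norm x)\<^sup>2 = (\<Sum>b\<in>Basis. (x \<bullet> b)\<^sup>2)"
  unfolding power2_norm_eq_inner by (subst euclidean_inner) (simp add: power2_eq_square)

text \<open>The product form of the definition serves coordinatewise arguments; continuity,
  boundedness and the self-duality under the Fourier transform are read off from this radial
  form.\<close>

lemma std_gaussian_density_eq:
  fixes z :: "'a::euclidean_space"
  shows "std_gaussian_density z = (1 / sqrt (2 * pi)) ^ DIM('a) * exp (- (norm z)\<^sup>2 / 2)"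
  by (simp add: std_gaussian_density_def std_normal_density_def prod_dividef
      power_one_over norm_power2_eq_sum_Basis sum_divide_distrib sum_negf flip: exp_sum)

lemma std_gaussian_density_nonneg [simp]: "0 \<le> std_gaussian_density z"
  by (simp add: std_gaussian_density_def prod_nonneg)

lemma continuous_on_std_gaussian_density: "continuous_on A std_gaussian_density"
  unfolding std_gaussian_density_eq[abs_def] by (intro continuous_intros) auto

lemma borel_measurable_std_gaussian_density [measurable]:
  "std_gaussian_density \<in> borel_measurable borel"
  by (intro borel_measurable_continuous_onI continuous_on_std_gaussian_density)

lemma prob_space_std_gaussian: "prob_space (std_gaussian :: 'a::euclidean_space measure)"
proof
  have "(\<integral>\<^sup>+z. ennreal (std_gaussian_density z) \<partial>(lborel :: 'a measure))
      = (\<integral>\<^sup>+z. (\<Prod>b\<in>Basis. ennreal (std_normal_density (z \<bullet> b))) \<partial>(lborel :: 'a measure))"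
    by (simp add: std_gaussian_density_def prod_ennreal)
  also have "\<dots> = (\<Prod>b\<in>(Basis::'a set). \<integral>\<^sup>+x. ennreal (std_normal_density x) \<partial>lborel)"
    by (rule nn_integral_lborel_prod) auto
  also have "(\<integral>\<^sup>+x. ennreal (std_normal_density x) \<partial>lborel) = 1"
    using prob_space.emeasure_space_1[OF prob_space_normal_density[of 1 0]]
    by (simp add: emeasure_density)
  finally show "emeasure (std_gaussian :: 'a measure) (space std_gaussian) = 1"
    by (simp add: emeasure_density)
qed

text \<open>Complex-valued counterpart of \<open>nn_integral_lborel_prod\<close>, needed for
  characteristic functions. \<open>lborel\<close> is the image of the product measure indexed by
  \<open>Basis\<close>, so Fubini for finite products applies.\<close>

lemma integral_lborel_prod:
  fixes f :: "'a::euclidean_space \<Rightarrow> real \<Rightarrow> complex"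
  assumes f: "\<And>b. b \<in> Basis \<Longrightarrow> integrable lborel (f b)"
  shows "(\<integral>x. (\<Prod>b\<in>Basis. f b (x \<bullet> b)) \<partial>lborel) = (\<Prod>b\<in>Basis. \<integral>x. f b x \<partial>lborel)"
proof -
  interpret product_sigma_finite "\<lambda>b::'a. lborel :: real measure" ..
  have [measurable]: "\<And>b. b \<in> Basis \<Longrightarrow> f b \<in> borel_measurable borel"
    using f by (auto dest: borel_measurable_integrable)
  have "(\<integral>x. (\<Prod>b\<in>Basis. f b (x \<bullet> b)) \<partial>lborel)
      = (\<integral>x. (\<Prod>b\<in>Basis. f b (x b)) \<partial>(\<Pi>\<^sub>M b\<in>(Basis::'a set). lborel))"
    by (subst lborel_eq) (simp add: integral_distr)
  also have "\<dots> = (\<Prod>b\<in>Basis. \<integral>x. f b x \<partial>lborel)"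
    using f by (intro product_integral_prod) auto
  finally show ?thesis .
qed

text \<open>Both the density and the exponential factor over the coordinates, which reduces the
  claim to the characteristic function of the one-dimensional standard normal law.\<close>

lemma std_gaussian_char:
  fixes \<xi> :: "'a::euclidean_space"
  shows "(CLINT z|std_gaussian. iexp (\<xi> \<bullet> z)) = complex_of_real (exp (- (norm \<xi>)\<^sup>2 / 2))"
proof -
  have 1: "(LINT u|lborel. std_normal_density u *\<^sub>R iexp (t * u)) = complex_of_real (exp (- t\<^sup>2 / 2))" for t
    using fun_cong[OF char_std_normal_distribution, of t]
    by (simp add: char_def integral_density)
  have int: "integrable lborel (\<lambda>u. std_normal_density u *\<^sub>R iexp (t * u))" for t
    by (rule Bochner_Integration.integrable_bound[OF integrable_normal_density[of 1 0]])
       (auto simp: norm_mult)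
  have "(CLINT z|std_gaussian. iexp (\<xi> \<bullet> z))
      = (LINT z|lborel. std_gaussian_density z *\<^sub>R iexp (\<xi> \<bullet> z))"
    by (simp add: integral_density)
  also have "\<dots> = (LINT z|lborel. (\<Prod>b\<in>Basis. std_normal_density (z \<bullet> b) *\<^sub>R iexp ((\<xi> \<bullet> b) * (z \<bullet> b))))"
  proof (intro Bochner_Integration.integral_cong refl)
    fix z :: 'a
    have "iexp (\<xi> \<bullet> z) = (\<Prod>b\<in>Basis. iexp ((\<xi> \<bullet> b) * (z \<bullet> b)))"
      by (subst euclidean_inner) (simp add: sum_distrib_left exp_sum)
    then show "std_gaussian_density z *\<^sub>R iexp (\<xi> \<bullet> z)
        = (\<Prod>b\<in>Basis. std_normal_density (z \<bullet> b) *\<^sub>R iexp ((\<xi> \<bullet> b) * (z \<bullet> b)))"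
      by (simp add: std_gaussian_density_def scaleR_conv_of_real prod.distrib)
  qed
  also have "\<dots> = (\<Prod>b\<in>Basis. LINT u|lborel. std_normal_density u *\<^sub>R iexp ((\<xi> \<bullet> b) * u))"
    by (rule integral_lborel_prod) (rule int)
  also have "\<dots> = (\<Prod>b\<in>Basis. complex_of_real (exp (- (\<xi> \<bullet> b)\<^sup>2 / 2)))"
    by (simp only: 1)
  also have "\<dots> = complex_of_real (exp (- (norm \<xi>)\<^sup>2 / 2))"
    by (simp add: norm_power2_eq_sum_Basis sum_divide_distrib sum_negf flip: of_real_prod exp_sum)
  finally show ?thesis .
qed

text \<open>The substitution \<open>v = z + (1 / \<sigma>) *\<^sub>R x\<close> moves the dependence
  on \<open>x\<close> from the argument of \<open>f\<close> into the density. Then \<open>x\<close>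
  can be integrated out, or varied, without any regularity of \<open>f\<close>. The Bochner version
  \<open>integral_std_gaussian_shift\<close> below serves the second purpose.\<close>

lemma nn_integral_std_gaussian_shift:
  fixes f :: "'a::euclidean_space \<Rightarrow> ennreal"
  assumes [measurable]: "f \<in> borel_measurable borel" and "\<sigma> \<noteq> 0"
  shows "(\<integral>\<^sup>+z. f (x + \<sigma> *\<^sub>R z) \<partial>std_gaussian)
    = (\<integral>\<^sup>+v. f (\<sigma> *\<^sub>R v) * ennreal (std_gaussian_density (v - (1 / \<sigma>) *\<^sub>R x)) \<partial>lborel)"
proof -
  have "(\<integral>\<^sup>+z. f (x + \<sigma> *\<^sub>R z) \<partial>std_gaussian)
      = (\<integral>\<^sup>+z. f (x + \<sigma> *\<^sub>R z) * ennreal (std_gaussian_density z) \<partial>lborel)"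
    by (subst nn_integral_density) (simp_all add: mult.commute)
  also have "\<dots> = (\<integral>\<^sup>+z. f (x + \<sigma> *\<^sub>R z) * ennreal (std_gaussian_density z)
      \<partial>distr lborel borel ((+) (- (1 / \<sigma>) *\<^sub>R x)))"
    by (simp add: lborel_distr_plus)
  also have "\<dots> = (\<integral>\<^sup>+v. f (\<sigma> *\<^sub>R v) * ennreal (std_gaussian_density (v - (1 / \<sigma>) *\<^sub>R x)) \<partial>lborel)"
    using \<open>\<sigma> \<noteq> 0\<close> by (subst nn_integral_distr) (simp_all add: algebra_simps)
  finally show ?thesis .
qed

lemma nn_integral_std_gaussian_density:
  "(\<integral>\<^sup>+v. ennreal (std_gaussian_density (v - a)) \<partial>lborel) = 1" for a :: "'a::euclidean_space"
proof -
  interpret G: prob_space "std_gaussian :: 'a measure" by (rule prob_space_std_gaussian)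
  show ?thesis
    using nn_integral_std_gaussian_shift[of "\<lambda>_. 1" 1 a] G.emeasure_space_1 by simp
qed

lemma integrable_std_gaussian_density: "integrable lborel (\<lambda>v. std_gaussian_density (v - a))"
  by (intro integrableI_bounded) (simp_all add: nn_integral_std_gaussian_density)

lemma integral_std_gaussian_shift:
  fixes f :: "'a::euclidean_space \<Rightarrow> real"
  assumes [measurable]: "f \<in> borel_measurable borel" and "r \<noteq> 0"
  shows "(LINT z|std_gaussian. f (x + r *\<^sub>R z))
    = (LINT v|lborel. f (r *\<^sub>R v) * std_gaussian_density (v - (1 / r) *\<^sub>R x))"
proof -
  have "(LINT z|std_gaussian. f (x + r *\<^sub>R z))
      = (LINT z|lborel. f (x + r *\<^sub>R z) * std_gaussian_density z)"
    by (simp add: integral_density mult.commute)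
  also have "\<dots> = (LINT z|distr lborel borel ((+) (- (1 / r) *\<^sub>R x)). f (x + r *\<^sub>R z) * std_gaussian_density z)"
    by (simp add: lborel_distr_plus)
  also have "\<dots> = (LINT v|lborel. f (r *\<^sub>R v) * std_gaussian_density (v - (1 / r) *\<^sub>R x))"
    using \<open>r \<noteq> 0\<close> by (subst integral_distr) (simp_all add: algebra_simps)
  finally show ?thesis .
qed

subsection \<open>Uniqueness of characteristic functions\<close>

text \<open>Up to its normalising constant the Gaussian density is its own Fourier
  transform.\<close>

lemma std_gaussian_density_inversion:
  fixes v :: "'a::euclidean_space"
  shows "complex_of_real (std_gaussian_density v)
    = complex_of_real ((1 / sqrt (2 * pi)) ^ DIM('a)) * (CLINT \<xi>|std_gaussian. iexp (v \<bullet> \<xi>))"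
  by (subst std_gaussian_char) (simp add: std_gaussian_density_eq)

text \<open>Integrate the Gaussian inversion formula at \<open>v - c *\<^sub>R x\<close> over
  \<open>M\<close> and swap the integrals: \<open>M\<close> then enters the right-hand side only
  through its characteristic function.\<close>

lemma integral_std_gaussian_density_char:
  fixes M :: "'a::euclidean_space measure"
  assumes "prob_space M" and [measurable_cong]: "sets M = sets borel"
  shows "complex_of_real (LINT x|M. std_gaussian_density (v - c *\<^sub>R x))
    = complex_of_real ((1 / sqrt (2 * pi)) ^ DIM('a)) *
      (CLINT \<xi>|std_gaussian. iexp (v \<bullet> \<xi>) * (CLINT x|M. iexp ((- c *\<^sub>R \<xi>) \<bullet> x)))"
proof -
  interpret M: prob_space M by fact
  interpret G: prob_space "std_gaussian :: 'a measure" by (rule prob_space_std_gaussian)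
  interpret P: pair_prob_space M "std_gaussian :: 'a measure" ..
  \<comment> \<open>The integrand has modulus 1 on a product of probability spaces, which justifies
    Fubini.\<close>
  have int: "integrable (M \<Otimes>\<^sub>M std_gaussian) (\<lambda>(x, \<xi>). iexp ((v - c *\<^sub>R x) \<bullet> \<xi>))"
    by (rule P.integrable_const_bound[of _ 1]) auto
  have "complex_of_real (LINT x|M. std_gaussian_density (v - c *\<^sub>R x))
      = complex_of_real ((1 / sqrt (2 * pi)) ^ DIM('a)) *
        (CLINT x|M. CLINT \<xi>|std_gaussian. iexp ((v - c *\<^sub>R x) \<bullet> \<xi>))"
    unfolding integral_complex_of_real[symmetric] std_gaussian_density_inversion by simp
  also have "(CLINT x|M. CLINT \<xi>|std_gaussian. iexp ((v - c *\<^sub>R x) \<bullet> \<xi>))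
      = (CLINT \<xi>|std_gaussian. CLINT x|M. iexp ((v - c *\<^sub>R x) \<bullet> \<xi>))"
    using P.Fubini_integral[OF int] by simp
  also have "\<dots> = (CLINT \<xi>|std_gaussian. iexp (v \<bullet> \<xi>) * (CLINT x|M. iexp ((- c *\<^sub>R \<xi>) \<bullet> x)))"
    unfolding integral_mult_right_zero[symmetric] exp_add[symmetric]
    by (simp add: inner_diff_left inner_commute[of v] inner_commute[of _ \<xi> for \<xi>] algebra_simps)
  finally show ?thesis .
qed

text \<open>Adding independent Gaussian noise of scale \<sigma> to \<open>M\<close> gives a law with
  a density in the rescaled variable \<open>v\<close>. By the previous lemma this density is
  determined by the characteristic function of \<open>M\<close>. The formula comes from the shift
  lemma and Tonelli.\<close>

lemma nn_integral_smoothing: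
  fixes M :: "'a::euclidean_space measure" and f :: "'a \<Rightarrow> ennreal"
  assumes "prob_space M" and [measurable_cong]: "sets M = sets borel"
    and [measurable]: "f \<in> borel_measurable borel" and "\<sigma> \<noteq> 0"
  shows "(\<integral>\<^sup>+x. \<integral>\<^sup>+z. f (x + \<sigma> *\<^sub>R z) \<partial>std_gaussian \<partial>M)
    = (\<integral>\<^sup>+v. f (\<sigma> *\<^sub>R v) * ennreal (LINT x|M. std_gaussian_density (v - (1 / \<sigma>) *\<^sub>R x)) \<partial>lborel)"
proof -
  interpret M: prob_space M by fact
  interpret P: pair_sigma_finite M "lborel :: 'a measure" ..
  \<comment> \<open>The density is bounded by its value at 0. Integrability lets the inner integral
    become a Bochner integral, the form in which the inversion formula is available.\<close>
  have int: "integrable M (\<lambda>x. std_gaussian_density (v - (1 / \<sigma>) *\<^sub>R x))" for v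
    by (rule M.integrable_const_bound[of _ "(1 / sqrt (2 * pi)) ^ DIM('a)"])
       (auto simp: std_gaussian_density_eq abs_mult power_abs intro!: mult_left_le)
  have "(\<integral>\<^sup>+x. \<integral>\<^sup>+z. f (x + \<sigma> *\<^sub>R z) \<partial>std_gaussian \<partial>M)
      = (\<integral>\<^sup>+x. \<integral>\<^sup>+v. f (\<sigma> *\<^sub>R v) * ennreal (std_gaussian_density (v - (1 / \<sigma>) *\<^sub>R x)) \<partial>lborel \<partial>M)"
    by (simp add: nn_integral_std_gaussian_shift[OF _ \<open>\<sigma> \<noteq> 0\<close>])
  also have "\<dots> = (\<integral>\<^sup>+v. \<integral>\<^sup>+x. f (\<sigma> *\<^sub>R v) * ennreal (std_gaussian_density (v - (1 / \<sigma>) *\<^sub>R x)) \<partial>M \<partial>lborel)"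
    by (rule P.Fubini'[symmetric]) simp
  also have "\<dots> = (\<integral>\<^sup>+v. f (\<sigma> *\<^sub>R v) * (\<integral>\<^sup>+x. ennreal (std_gaussian_density (v - (1 / \<sigma>) *\<^sub>R x)) \<partial>M) \<partial>lborel)"
    by (simp add: nn_integral_cmult)
  also have "\<dots> = (\<integral>\<^sup>+v. f (\<sigma> *\<^sub>R v) * ennreal (LINT x|M. std_gaussian_density (v - (1 / \<sigma>) *\<^sub>R x)) \<partial>lborel)"
    using int by (simp add: nn_integral_eq_integral)
  finally show ?thesis .
qed

text \<open>Dominated convergence is applied first in \<open>z\<close>, by continuity of
  \<open>f\<close>, and then in \<open>x\<close>. The constant 1 dominates both times:
  \<open>ennreal\<close> sends negative values to 0, so an upper bound on \<open>f\<close> controls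
  the integrand.\<close>

lemma tendsto_nn_integral_smoothing:
  fixes M :: "'a::euclidean_space measure" and f :: "'a \<Rightarrow> real"
  assumes "prob_space M" and [measurable_cong]: "sets M = sets borel"
    and f: "continuous_on UNIV f" "\<And>x. f x \<le> 1"
    and \<sigma>: "\<sigma> \<longlonglongrightarrow> 0"
  shows "(\<lambda>n. \<integral>\<^sup>+x. \<integral>\<^sup>+z. ennreal (f (x + \<sigma> n *\<^sub>R z)) \<partial>std_gaussian \<partial>M)
    \<longlonglongrightarrow> (\<integral>\<^sup>+x. ennreal (f x) \<partial>M)"
proof -
  interpret M: prob_space M by fact
  interpret G: prob_space "std_gaussian :: 'a measure" by (rule prob_space_std_gaussian)
  have [measurable]: "f \<in> borel_measurable borel"
    using f by (intro borel_measurable_continuous_onI)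
  have le1: "ennreal (f x) \<le> 1" for x
    using f(2)[of x] by (metis ennreal_1 ennreal_leI)
  have G1: "emeasure (std_gaussian :: 'a measure) UNIV = 1"
    using G.emeasure_space_1 by simp
  have inner: "(\<lambda>n. \<integral>\<^sup>+z. ennreal (f (x + \<sigma> n *\<^sub>R z)) \<partial>std_gaussian) \<longlonglongrightarrow> ennreal (f x)" for x
  proof -
    have "(\<lambda>n. f (x + \<sigma> n *\<^sub>R z)) \<longlonglongrightarrow> f (x + 0 *\<^sub>R z)" for z
      using f(1) \<sigma> by (intro continuous_on_tendsto_compose[OF f(1)] tendsto_intros) auto
    then have "(\<lambda>n. \<integral>\<^sup>+z. ennreal (f (x + \<sigma> n *\<^sub>R z)) \<partial>(std_gaussian :: 'a measure))
        \<longlonglongrightarrow> (\<integral>\<^sup>+z. ennreal (f x) \<partial>(std_gaussian :: 'a measure))"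
      using le1 G1 by (intro nn_integral_dominated_convergence[where w = "\<lambda>_. 1"]) auto
    then show ?thesis
      using G1 by simp
  qed
  have "(\<integral>\<^sup>+z. ennreal (f (x + \<sigma> n *\<^sub>R z)) \<partial>std_gaussian) \<le> (\<integral>\<^sup>+z. 1 \<partial>(std_gaussian :: 'a measure))" for x n
    by (intro nn_integral_mono le1)
  then have bd: "(\<integral>\<^sup>+z. ennreal (f (x + \<sigma> n *\<^sub>R z)) \<partial>std_gaussian) \<le> 1" for x n
    using G.emeasure_space_1 by simp
  show ?thesis
    using inner bd M.emeasure_space_1
    by (intro nn_integral_dominated_convergence[where w = "\<lambda>_. 1"]) auto
qed

text \<open>Smoothing a law by a small Gaussian gives a density that the inversion formula expresses
  through the characteristic function; the smoothing is then removed by letting its scale tend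
  to \<open>0\<close>.\<close>

lemma char_eq_imp_nn_integral_eq:
  fixes M N :: "'a::euclidean_space measure" and f :: "'a \<Rightarrow> real"
  assumes M: "prob_space M" "sets M = sets borel" and N: "prob_space N" "sets N = sets borel"
    and char: "\<And>\<xi>. (CLINT x|M. iexp (\<xi> \<bullet> x)) = (CLINT x|N. iexp (\<xi> \<bullet> x))"
    and f: "continuous_on UNIV f" "\<And>x. f x \<le> 1"
  shows "(\<integral>\<^sup>+x. ennreal (f x) \<partial>M) = (\<integral>\<^sup>+x. ennreal (f x) \<partial>N)"
proof -
  have [measurable]: "f \<in> borel_measurable borel"
    using f by (intro borel_measurable_continuous_onI)
  have "(LINT x|M. std_gaussian_density (v - c *\<^sub>R x)) = (LINT x|N. std_gaussian_density (v - c *\<^sub>R x))" for v c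
    using integral_std_gaussian_density_char[OF M, of v c] integral_std_gaussian_density_char[OF N, of v c]
    unfolding char by (metis of_real_eq_iff)
  then have eq: "(\<integral>\<^sup>+x. \<integral>\<^sup>+z. ennreal (f (x + \<sigma> *\<^sub>R z)) \<partial>std_gaussian \<partial>M)
      = (\<integral>\<^sup>+x. \<integral>\<^sup>+z. ennreal (f (x + \<sigma> *\<^sub>R z)) \<partial>std_gaussian \<partial>N)" if "\<sigma> \<noteq> 0" for \<sigma>
    using that nn_integral_smoothing[OF M, of "\<lambda>x. ennreal (f x)" \<sigma>]
      nn_integral_smoothing[OF N, of "\<lambda>x. ennreal (f x)" \<sigma>] by simp
  define \<sigma> where "\<sigma> n = 1 / real (Suc n)" for n
  have \<sigma>: "\<sigma> \<longlonglongrightarrow> 0" "\<And>n. \<sigma> n \<noteq> 0"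
    unfolding \<sigma>_def using LIMSEQ_inverse_real_of_nat by (auto simp: inverse_eq_divide)
  show ?thesis
    using tendsto_nn_integral_smoothing[OF M f \<sigma>(1)] tendsto_nn_integral_smoothing[OF N f \<sigma>(1)]
    unfolding eq[OF \<sigma>(2)] by (rule LIMSEQ_unique)
qed

text \<open>Open sets form an intersection-stable generator of the Borel sets, and the indicator of
  an open set is the pointwise limit of continuous functions with values at most 1, for which the
  integrals already agree.\<close>

lemma char_eq_imp_measure_eq:
  fixes M N :: "'a::euclidean_space measure"
  assumes M: "prob_space M" "sets M = sets borel" and N: "prob_space N" "sets N = sets borel"
    and char: "\<And>\<xi>. (CLINT x|M. iexp (\<xi> \<bullet> x)) = (CLINT x|N. iexp (\<xi> \<bullet> x))"
  shows "M = N"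
proof (rule measure_eqI_generator_eq)
  interpret M: prob_space M by (rule M)
  interpret N: prob_space N by (rule N)
  let ?E = "{S :: 'a set. open S}"
  show "Int_stable ?E" by (auto simp: Int_stable_def)
  show "?E \<subseteq> Pow UNIV" "sets M = sigma_sets UNIV ?E" "sets N = sigma_sets UNIV ?E"
    using M(2) N(2) by (auto simp: borel_def)
  show "range (\<lambda>_::nat. UNIV) \<subseteq> ?E" "(\<Union>i::nat. UNIV) = (UNIV :: 'a set)"
    "emeasure M UNIV \<noteq> \<infinity>" by auto
  have sp: "space M = UNIV" "space N = UNIV"
    using M(2) N(2) by (auto dest!: sets_eq_imp_space_eq)
  fix U :: "'a set" assume "U \<in> ?E"
  then have U: "open U" by simp
  show "emeasure M U = emeasure N U"
  \<comment> \<open>The whole space is treated apart because \<open>infdist\<close> to the empty set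
    is 0 by convention, so the approximating functions would vanish identically.\<close>
  proof (cases "U = UNIV")
    case True
    then show ?thesis using M.emeasure_space_1 N.emeasure_space_1 sp by simp
  next
    case False
    define f where "f n x = min 1 (real n * infdist x (- U))" for n x
    have f: "continuous_on UNIV (f n)" "f n x \<le> 1" for n x
      unfolding f_def by (auto intro!: continuous_intros)
    have [measurable]: "f n \<in> borel_measurable borel" for n
      using f by (intro borel_measurable_continuous_onI)
    have lim: "(\<lambda>n. ennreal (f n x)) \<longlonglongrightarrow> indicator U x" for x
    proof (cases "x \<in> U")
      case True
      then have "infdist x (- U) > 0"
        using U False in_closed_iff_infdist_zero[of "- U" x] infdist_nonneg[of x "- U"]
        by (fastforce simp: closed_def order_less_le)
      then obtain n0 where n0: "1 < real n0 * infdist x (- U)"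
        using reals_Archimedean3 by blast
      have "f n x = 1" if "n \<ge> n0" for n
        using n0 mult_right_mono[of "real n0" "real n" "infdist x (- U)"] that infdist_nonneg[of x "- U"]
        by (simp add: f_def)
      then have "\<forall>\<^sub>F n in sequentially. ennreal (f n x) = indicator U x"
        using True by (auto simp: eventually_sequentially intro!: exI[of _ n0])
      then show ?thesis by (rule tendsto_eventually)
    next
      case False
      then show ?thesis by (simp add: f_def)
    qed
    have le1: "ennreal (f n x) \<le> 1" for n x
      using f(2)[of n x] by (metis ennreal_1 ennreal_leI)
    have conv: "(\<lambda>n. \<integral>\<^sup>+x. ennreal (f n x) \<partial>K) \<longlonglongrightarrow> emeasure K U"
      if "prob_space K" and [measurable_cong]: "sets K = sets borel" for K
    proof -
      interpret K: prob_space K by fact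
      have [measurable]: "U \<in> sets borel" using U by simp
      have "(\<lambda>n. \<integral>\<^sup>+x. ennreal (f n x) \<partial>K) \<longlonglongrightarrow> (\<integral>\<^sup>+x. indicator U x \<partial>K)"
        using lim le1 U K.emeasure_space_1
        by (intro nn_integral_dominated_convergence[where w = "\<lambda>_. 1"]) auto
      then show ?thesis using U that(2) by simp
    qed
    show ?thesis
      using conv[OF M] conv[OF N] char_eq_imp_nn_integral_eq[OF M N char f]
      by (simp add: LIMSEQ_unique)
  qed
qed

subsection \<open>Harmonic functions and exit times\<close>

text \<open>Overwriting all functions by a constant on a null set that contains the points of
  non-convergence yields a genuine pointwise limit, hence a measurable one. By completeness,
  preimages that differ only within a null set are measurable together.\<close>

lemma (in complete_measure) borel_measurable_AE_LIMSEQ: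
  fixes u :: "nat \<Rightarrow> 'a \<Rightarrow> 'b::metric_space"
  assumes u [measurable]: "\<And>n. u n \<in> borel_measurable M"
    and lim: "AE x in M. (\<lambda>n. u n x) \<longlonglongrightarrow> f x"
  shows "f \<in> borel_measurable M"
proof -
  obtain N where N: "N \<in> null_sets M" "{x \<in> space M. \<not> (\<lambda>n. u n x) \<longlonglongrightarrow> f x} \<subseteq> N"
    using lim by (auto simp: eventually_ae_filter)
  have [measurable]: "N \<in> sets M" using N by auto
  define g where "g x = (if x \<in> N then undefined else f x)" for x
  have g: "g \<in> borel_measurable M"
  proof (rule borel_measurable_LIMSEQ_metric)
    show "(\<lambda>x. if x \<in> N then undefined else u n x) \<in> borel_measurable M" for n
      by simp
    show "(\<lambda>n. if x \<in> N then undefined else u n x) \<longlonglongrightarrow> g x" if "x \<in> space M" for x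
      using N(2) that by (auto simp: g_def)
  qed
  show ?thesis
  proof (rule measurableI)
    fix A :: "'b set" assume A: "A \<in> sets borel"
    have "AE x in M. x \<notin> N" using N(1) by (rule AE_not_in)
    then have "AE x in M. x \<in> g -` A \<inter> space M \<longleftrightarrow> x \<in> f -` A \<inter> space M"
      by eventually_elim (simp add: g_def)
    then show "f -` A \<inter> space M \<in> sets M"
      by (rule in_sets_AE) (use measurable_sets[OF g A] in auto)
  qed simp
qed

lemma prob_space_completion: "prob_space M \<Longrightarrow> prob_space (completion M)"
  using prob_space.emeasure_space_1 by (intro prob_spaceI) auto

text \<open>The exit time is at least \<open>t\<close>, possibly equal to \<open>t\<close>, or
  \<infinity> when the set of exit instants is empty. In every case its minimum with
  \<open>t\<close> is \<open>t\<close>.\<close>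

lemma stopped_at_exit_eq:
  assumes "\<And>s. 0 < s \<Longrightarrow> s \<le> t \<Longrightarrow> X s \<omega> \<in> D"
  shows "stopped_at_exit X D t \<omega> = X t \<omega>"
proof -
  have "ereal t \<le> exit_time X D \<omega>"
    unfolding exit_time_def
  proof (rule INF_greatest)
    fix s assume "s \<in> {s. 0 < s \<and> X s \<omega> \<notin> D}"
    then show "ereal t \<le> ereal s" using assms[of s] by (cases "s \<le> t") auto
  qed
  then show ?thesis by (simp add: stopped_at_exit_def min_def)
qed

text \<open>Each path stays in all sufficiently large balls up to time \<open>t\<close>, so the
  stopped value coincides with \<open>x + X t \<omega>\<close> from some index on. This is stronger
  than convergence and passes through \<phi>, which is only measurable. The expectations along the
  sequence all equal \<open>\<phi> x\<close>.\<close>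

lemma process_harmonic_mean_value:
  fixes X :: "real \<Rightarrow> 'w \<Rightarrow> 'b::euclidean_space"
  assumes M: "prob_space M" and harm: "process_harmonic M X \<phi>" and C: "\<And>x. \<bar>\<phi> x\<bar> \<le> C"
    and "t > 0" and X [measurable]: "X t \<in> borel_measurable (completion M)"
    and bdd: "AE \<omega> in M. bounded ((\<lambda>s. X s \<omega>) ` {0..t})"
  shows "\<phi> x = (LINT \<omega>|completion M. \<phi> (x + X t \<omega>))"
proof -
  interpret prob_space "completion M" by (intro prob_space_completion M)
  have \<phi> [measurable]: "\<phi> \<in> borel_measurable borel"
    using harm by (simp add: process_harmonic_def)
  \<comment> \<open>The radius \<open>Suc n\<close> is positive for every \<open>n\<close>, so
    \<open>x\<close> lies in each ball and harmonicity applies.\<close>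
  define Y where "Y n = stopped_at_exit (\<lambda>s \<omega>. x + X s \<omega>) (ball x (real (Suc n))) t" for n
  have Y: "has_bochner_integral (completion M) (\<lambda>\<omega>. \<phi> (Y n \<omega>)) (\<phi> x)" for n
    using harm \<open>t > 0\<close> unfolding process_harmonic_def Y_def by auto
  have "(\<lambda>n. LINT \<omega>|completion M. \<phi> (Y n \<omega>)) \<longlonglongrightarrow> (LINT \<omega>|completion M. \<phi> (x + X t \<omega>))"
  proof (rule integral_dominated_convergence[where w = "\<lambda>_. C"])
    show "AE \<omega> in completion M. (\<lambda>n. \<phi> (Y n \<omega>)) \<longlonglongrightarrow> \<phi> (x + X t \<omega>)"
      using AE_completion[OF bdd]
    proof eventually_elim
      case (elim \<omega>)
      then obtain R where R: "\<And>s. 0 \<le> s \<Longrightarrow> s \<le> t \<Longrightarrow> norm (X s \<omega>) \<le> R"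
        unfolding bounded_iff by (metis atLeastAtMost_iff imageI)
      obtain n0 where n0: "R < real n0" using reals_Archimedean2 by blast
      have "Y n \<omega> = x + X t \<omega>" if "n \<ge> n0" for n
        unfolding Y_def
      proof (rule stopped_at_exit_eq)
        fix s assume s: "0 < s" "s \<le> t"
        then have "norm (X s \<omega>) < real (Suc n)" using R[of s] n0 that by simp
        then show "x + X s \<omega> \<in> ball x (real (Suc n))" by (simp add: dist_norm)
      qed
      then show ?case
        unfolding eventually_sequentially by (intro tendsto_eventually eventually_sequentiallyI[of n0]) simp
    qed
    \<comment> \<open>Measurability is part of the existence statement in
      \<open>process_harmonic\<close>; no measurability of the exit time itself is invoked.\<close>
    show "(\<lambda>\<omega>. \<phi> (Y n \<omega>)) \<in> borel_measurable (completion M)" for n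
      using Y by (auto dest: borel_measurable_has_bochner_integral)
  qed (use C in auto)
  then show ?thesis
    by (simp add: has_bochner_integral_integral_eq[OF Y] LIMSEQ_const_iff)
qed

subsection \<open>The law of subordinate Brownian motion\<close>

text \<open>The cap \<open>n * n\<close> makes a random time discretised on the grid of mesh \<open>1 / n\<close> take only
  finitely many values, so that its independence of \<open>B\<close> can be used termwise.\<close>

definition grid_index :: "nat \<Rightarrow> real \<Rightarrow> nat" where
  "grid_index n s = min (nat \<lfloor>real n * s\<rfloor>) (n * n)"

lemma measurable_grid_index [measurable]: "grid_index n \<in> borel \<rightarrow>\<^sub>M count_space UNIV"
  unfolding grid_index_def[abs_def] by measurable

text \<open>As soon as \<open>n \<ge> s\<close>, the cap \<open>n * n\<close> is inactive and only
  the rounding error of at most \<open>1 / n\<close> remains.\<close>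

lemma tendsto_grid_index:
  assumes "0 \<le> s"
  shows "(\<lambda>n. real (grid_index n s) / real n) \<longlonglongrightarrow> s"
proof -
  have bd: "\<bar>real (grid_index n s) / real n - s\<bar> \<le> inverse (real n)" if n: "n > 0" "s \<le> real n" for n
  proof -
    have "real n * s \<le> real n * real n" using n by (intro mult_left_mono) auto
    then have "\<lfloor>real n * s\<rfloor> \<le> int (n * n)" by (simp add: floor_le_iff)
    then have "grid_index n s = nat \<lfloor>real n * s\<rfloor>" by (simp add: grid_index_def nat_le_iff min_absorb1)
    then have "\<bar>real (grid_index n s) - real n * s\<bar> \<le> 1"
      using assms by (simp add: of_nat_nat) linarith
    then show ?thesis using n by (simp add: field_simps abs_le_iff)
  qed
  have ev: "\<forall>\<^sub>F n in sequentially. \<bar>real (grid_index n s) / real n - s\<bar> \<le> inverse (real n)"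
  proof -
    obtain n0 where "s \<le> real n0" using real_arch_simple by blast
    then show ?thesis
      unfolding eventually_sequentially by (intro exI[of _ "Suc n0"]) (auto intro!: bd)
  qed
  have "(\<lambda>n. real (grid_index n s) / real n - s) \<longlonglongrightarrow> 0"
    using ev by (intro Lim_null_comparison[OF _ lim_inverse_n]) auto
  then show ?thesis by (simp add: LIM_zero_iff)
qed

text \<open>The sigma-algebra generated by a measurable function of one time value lies in that of
  the whole process, so independence is inherited.\<close>

lemma independent_processes_indep_var:
  assumes M: "prob_space M" and ind: "independent_processes M X Y" and st: "0 \<le> s" "0 \<le> t"
    and X: "X s \<in> borel_measurable M" and Y: "Y t \<in> borel_measurable M"
    and f: "f \<in> borel \<rightarrow>\<^sub>M N" and g: "g \<in> borel \<rightarrow>\<^sub>M N'"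
  shows "prob_space.indep_var M N (\<lambda>\<omega>. f (X s \<omega>)) N' (\<lambda>\<omega>. g (Y t \<omega>))"
proof -
  interpret prob_space M by fact
  have sub: "sigma_sets (space M) {(\<lambda>\<omega>. h (Z r \<omega>)) -` A \<inter> space M | A. A \<in> sets K} \<subseteq> process_sigma_sets M Z"
    if "0 \<le> r" and h: "h \<in> borel \<rightarrow>\<^sub>M K" for Z :: "real \<Rightarrow> 'a \<Rightarrow> 'e::topological_space" and r h and K :: "'f measure"
    unfolding process_sigma_sets_def
  proof (intro sigma_sets_mono' subsetI)
    fix E assume "E \<in> {(\<lambda>\<omega>. h (Z r \<omega>)) -` A \<inter> space M | A. A \<in> sets K}"
    then obtain A where A: "A \<in> sets K" "E = (\<lambda>\<omega>. h (Z r \<omega>)) -` A \<inter> space M" by blast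
    then have "h -` A \<in> sets borel" using measurable_sets[OF h] by simp
    moreover have "E = Z r -` (h -` A) \<inter> space M" using A by auto
    ultimately show "E \<in> {Z t -` A \<inter> space M | t A. t \<ge> 0 \<and> A \<in> sets borel}"
      using \<open>0 \<le> r\<close> by blast
  qed
  have "indep_set (sigma_sets (space M) {(\<lambda>\<omega>. f (X s \<omega>)) -` A \<inter> space M | A. A \<in> sets N})
     (sigma_sets (space M) {(\<lambda>\<omega>. g (Y t \<omega>)) -` A \<inter> space M | A. A \<in> sets N'})"
    using ind sub[OF st(1) f, of X] sub[OF st(2) g, of Y]
    unfolding independent_processes_def indep_sets2_eq by (meson subsetD subset_trans)
  moreover have "(\<lambda>\<omega>. f (X s \<omega>)) \<in> M \<rightarrow>\<^sub>M N" "(\<lambda>\<omega>. g (Y t \<omega>)) \<in> M \<rightarrow>\<^sub>M N'"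
    using X Y f g by measurable
  ultimately show ?thesis
    unfolding indep_var_eq by blast
qed

text \<open>Split the expectation over the finitely many values \<open>k / n\<close> of the
  discretised time, factor each term by independence, insert the characteristic function of
  \<open>B\<close> at the fixed time \<open>k / n\<close>, and reassemble the sum.\<close>

lemma char_grid_subordination:
  fixes B :: "real \<Rightarrow> 'w \<Rightarrow> 'b::euclidean_space"
  assumes B: "brownian_motion M B" and ind: "independent_processes M B S"
    and S [measurable]: "S t \<in> borel_measurable M" and "0 \<le> t" and "0 < n"
  shows "(CLINT \<omega>|M. iexp (\<xi> \<bullet> B (real (grid_index n (S t \<omega>)) / real n) \<omega>))
    = complex_of_real (LINT \<omega>|M. exp (- (real (grid_index n (S t \<omega>)) / real n) * (norm \<xi>)\<^sup>2))"
proof -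
  have M: "prob_space M" and B_meas: "\<And>s. s \<ge> 0 \<Longrightarrow> B s \<in> borel_measurable M"
    and B_char: "\<And>s. s \<ge> 0 \<Longrightarrow> (CLINT \<omega>|M. iexp (\<xi> \<bullet> B s \<omega>)) = complex_of_real (exp (- s * (norm \<xi>)\<^sup>2))"
    using B by (auto simp: brownian_motion_def levy_process_def)
  interpret prob_space M by (rule M)
  have [measurable]: "B (real k / real n) \<in> borel_measurable M" for k by (rule B_meas) simp
  define I :: "nat \<Rightarrow> real \<Rightarrow> complex" where "I k s = indicator {k} (grid_index n s)" for k s
  define T where "T k = real k / real n" for k
  have [measurable]: "I k \<in> borel_measurable borel" for k
    unfolding I_def by (rule measurable_compose[OF measurable_grid_index]) simp
  have [measurable]: "B (T k) \<in> borel_measurable M" for k unfolding T_def by measurable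
  have le: "grid_index n s \<in> {..n * n}" for s by (simp add: grid_index_def)
  \<comment> \<open>Read from right to left this splits a function of the random index over its
    values, and from left to right it reassembles it; both directions occur below.\<close>
  have expand: "(\<Sum>k\<le>n * n. h k * I k s) = h (grid_index n s)" for h s
    using le[of s] by (simp add: I_def indicator_def if_distrib sum.delta' cong: if_cong)
  have nI: "norm (I k s) \<le> 1" for k s by (simp add: I_def indicator_def)
  have int_I: "integrable M (\<lambda>\<omega>. I k (S t \<omega>))" for k
    by (rule integrable_const_bound[of _ 1]) (auto simp: nI)
  have int_B: "integrable M (\<lambda>\<omega>. iexp (\<xi> \<bullet> B (T k) \<omega>))" for k
    by (rule integrable_const_bound[of _ 1]) auto
  have iv: "indep_var borel (\<lambda>\<omega>. iexp (\<xi> \<bullet> B (T k) \<omega>)) borel (\<lambda>\<omega>. I k (S t \<omega>))" for k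
    using \<open>0 \<le> t\<close> by (intro independent_processes_indep_var[OF M ind, where f = "\<lambda>x. iexp (\<xi> \<bullet> x)"])
       (auto simp: T_def)
  have "(CLINT \<omega>|M. iexp (\<xi> \<bullet> B (T (grid_index n (S t \<omega>))) \<omega>))
      = (CLINT \<omega>|M. \<Sum>k\<le>n * n. iexp (\<xi> \<bullet> B (T k) \<omega>) * I k (S t \<omega>))"
    by (simp only: expand)
  also have "\<dots> = (\<Sum>k\<le>n * n. CLINT \<omega>|M. iexp (\<xi> \<bullet> B (T k) \<omega>) * I k (S t \<omega>))"
    by (intro Bochner_Integration.integral_sum indep_var_integrable iv int_B int_I)
  also have "\<dots> = (\<Sum>k\<le>n * n. (CLINT \<omega>|M. iexp (\<xi> \<bullet> B (T k) \<omega>)) * (CLINT \<omega>|M. I k (S t \<omega>)))"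
    by (intro sum.cong refl indep_var_lebesgue_integral iv int_B int_I)
  also have "\<dots> = (\<Sum>k\<le>n * n. CLINT \<omega>|M. complex_of_real (exp (- T k * (norm \<xi>)\<^sup>2)) * I k (S t \<omega>))"
    by (subst B_char) (simp_all add: T_def)
  also have "\<dots> = (CLINT \<omega>|M. \<Sum>k\<le>n * n. complex_of_real (exp (- T k * (norm \<xi>)\<^sup>2)) * I k (S t \<omega>))"
    by (intro Bochner_Integration.integral_sum[symmetric] integrable_mult_right int_I)
  also have "\<dots> = (CLINT \<omega>|M. complex_of_real (exp (- T (grid_index n (S t \<omega>)) * (norm \<xi>)\<^sup>2)))"
    by (simp only: expand)
  also have "\<dots> = complex_of_real (LINT \<omega>|M. exp (- T (grid_index n (S t \<omega>)) * (norm \<xi>)\<^sup>2))"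
    by (rule integral_complex_of_real)
  finally show ?thesis by (simp only: T_def)
qed

text \<open>\<open>B\<^bsub>S\<^esub>\<close> is measurable only as an almost sure limit of its discretisations, hence the
  completion.\<close>

lemma subordination:
  fixes B :: "real \<Rightarrow> 'w \<Rightarrow> 'b::euclidean_space"
  assumes B: "brownian_motion M B" and S: "subordinator \<Psi> M S" and ind: "independent_processes M B S"
    and t: "0 \<le> t"
  shows subordination_measurable: "(\<lambda>\<omega>. B (S t \<omega>) \<omega>) \<in> borel_measurable (completion M)"
    and subordination_char: "(CLINT \<omega>|completion M. iexp (\<xi> \<bullet> B (S t \<omega>) \<omega>))
      = complex_of_real (LINT \<omega>|completion M. exp (- S t \<omega> * (norm \<xi>)\<^sup>2))"
    and subordination_bounded: "AE \<omega> in M. bounded ((\<lambda>s. B (S s \<omega>) \<omega>) ` {0..t})"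
    and subordinator_nonneg: "AE \<omega> in M. 0 \<le> S t \<omega>"
proof -
  have M: "prob_space M" and B_meas: "\<And>s. s \<ge> 0 \<Longrightarrow> B s \<in> borel_measurable M"
    and S_meas [measurable]: "S t \<in> borel_measurable M"
    using B S t by (auto simp: brownian_motion_def subordinator_def levy_process_def)
  interpret C: prob_space "completion M" by (intro prob_space_completion M)
  have "AE \<omega> in M. S 0 \<omega> = 0" "AE \<omega> in M. mono_on {0..} (\<lambda>t. S t \<omega>)"
    "AE \<omega> in M. continuous_on {0..} (\<lambda>t. B t \<omega>)"
    using B S by (auto simp: brownian_motion_def subordinator_def levy_process_def)
  then have path: "AE \<omega> in M. (\<forall>s\<ge>0. 0 \<le> S s \<omega>) \<and> mono_on {0..} (\<lambda>t. S t \<omega>) \<and> continuous_on {0..} (\<lambda>t. B t \<omega>)"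
  proof eventually_elim
    case (elim \<omega>)
    then show ?case using mono_onD[OF elim(2), of 0] by simp
  qed
  then show nonneg: "AE \<omega> in M. 0 \<le> S t \<omega>" by eventually_elim (use t in auto)
  show "AE \<omega> in M. bounded ((\<lambda>s. B (S s \<omega>) \<omega>) ` {0..t})"
    using path
  proof eventually_elim
    case (elim \<omega>)
    then have "continuous_on {0..S t \<omega>} (\<lambda>u. B u \<omega>)" by (auto intro: continuous_on_subset)
    then have "bounded ((\<lambda>u. B u \<omega>) ` {0..S t \<omega>})"
      by (intro compact_imp_bounded compact_continuous_image) auto
    \<comment> \<open>Monotonicity of \<open>S\<close> keeps all times \<open>S s \<omega>\<close>
      with \<open>s \<le> t\<close> in the compact interval \<open>{0..S t \<omega>}\<close>, on
      which the Brownian path is continuous.\<close>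
    moreover have "(\<lambda>s. B (S s \<omega>) \<omega>) ` {0..t} \<subseteq> (\<lambda>u. B u \<omega>) ` {0..S t \<omega>}"
      using elim mono_onD[of "{0..}" "\<lambda>t. S t \<omega>" _ t] by auto
    ultimately show ?case by (rule bounded_subset)
  qed
  define Q where "Q n \<omega> = real (grid_index n (S t \<omega>)) / real n" for n \<omega>
  have Q_meas [measurable]: "Q n \<in> borel_measurable M" for n unfolding Q_def by measurable
  have BQ [measurable]: "(\<lambda>\<omega>. B (Q n \<omega>) \<omega>) \<in> borel_measurable M" for n
    unfolding Q_def
  proof (rule measurable_compose_countable[where f = "\<lambda>k \<omega>. B (real k / real n) \<omega>" and g = "\<lambda>\<omega>. grid_index n (S t \<omega>)"])
    show "(\<lambda>\<omega>. B (real k / real n) \<omega>) \<in> borel_measurable M" for k by (rule B_meas) simp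
  qed measurable
  have Q_lim: "AE \<omega> in completion M. (\<lambda>n. Q n \<omega>) \<longlonglongrightarrow> S t \<omega>"
    using AE_completion[OF nonneg] by eventually_elim (simp add: Q_def tendsto_grid_index)
  have B_lim: "AE \<omega> in completion M. (\<lambda>n. B (Q n \<omega>) \<omega>) \<longlonglongrightarrow> B (S t \<omega>) \<omega>"
    using AE_completion[OF path] Q_lim
  proof eventually_elim
    case (elim \<omega>)
    with t show ?case
      by (intro continuous_on_tendsto_compose[of "{0..}" "\<lambda>u. B u \<omega>"]) (auto simp: Q_def)
  qed
  show BS [measurable]: "(\<lambda>\<omega>. B (S t \<omega>) \<omega>) \<in> borel_measurable (completion M)"
    using B_lim by (intro completion.borel_measurable_AE_LIMSEQ[OF measurable_completion[OF BQ]])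
  have [measurable]: "S t \<in> borel_measurable (completion M)"
    "\<And>n. Q n \<in> borel_measurable (completion M)"
    "\<And>n. (\<lambda>\<omega>. B (Q n \<omega>) \<omega>) \<in> borel_measurable (completion M)"
    by (intro measurable_completion, measurable)+
  have lim1: "(\<lambda>n. CLINT \<omega>|completion M. iexp (\<xi> \<bullet> B (Q n \<omega>) \<omega>))
      \<longlonglongrightarrow> (CLINT \<omega>|completion M. iexp (\<xi> \<bullet> B (S t \<omega>) \<omega>))"
  proof (rule integral_dominated_convergence[where w = "\<lambda>_. 1"])
    show "AE \<omega> in completion M. (\<lambda>n. iexp (\<xi> \<bullet> B (Q n \<omega>) \<omega>)) \<longlonglongrightarrow> iexp (\<xi> \<bullet> B (S t \<omega>) \<omega>)"
      using B_lim by eventually_elim (intro tendsto_intros)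
  qed auto
  have lim2: "(\<lambda>n. LINT \<omega>|completion M. exp (- Q n \<omega> * (norm \<xi>)\<^sup>2))
      \<longlonglongrightarrow> (LINT \<omega>|completion M. exp (- S t \<omega> * (norm \<xi>)\<^sup>2))"
  proof (rule integral_dominated_convergence[where w = "\<lambda>_. 1"])
    show "AE \<omega> in completion M. (\<lambda>n. exp (- Q n \<omega> * (norm \<xi>)\<^sup>2)) \<longlonglongrightarrow> exp (- S t \<omega> * (norm \<xi>)\<^sup>2)"
      using Q_lim by eventually_elim (intro tendsto_intros)
  qed (auto simp: Q_def)
  \<comment> \<open>The grid identity is available for \<open>0 < n\<close>, so the two sequences
    are compared from index 1 on and their limits coincide.\<close>
  have "\<forall>\<^sub>F n in sequentially. (CLINT \<omega>|completion M. iexp (\<xi> \<bullet> B (Q n \<omega>) \<omega>))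
      = complex_of_real (LINT \<omega>|completion M. exp (- Q n \<omega> * (norm \<xi>)\<^sup>2))"
  proof (rule eventually_sequentiallyI[of 1])
    fix n :: nat assume "1 \<le> n"
    then show "(CLINT \<omega>|completion M. iexp (\<xi> \<bullet> B (Q n \<omega>) \<omega>))
        = complex_of_real (LINT \<omega>|completion M. exp (- Q n \<omega> * (norm \<xi>)\<^sup>2))"
      using char_grid_subordination[OF B ind S_meas t, of n \<xi>]
      by (simp add: integral_completion Q_def[symmetric])
  qed
  then show "(CLINT \<omega>|completion M. iexp (\<xi> \<bullet> B (S t \<omega>) \<omega>))
      = complex_of_real (LINT \<omega>|completion M. exp (- S t \<omega> * (norm \<xi>)\<^sup>2))"
    using LIMSEQ_unique[OF lim1] tendsto_of_real[OF lim2] by (simp add: tendsto_cong)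
qed

text \<open>Given \<open>S t = s\<close>, the value of \<open>B\<close> has characteristic function
  \<open>exp (- s * (norm \<xi>)\<^sup>2)\<close>, that is variance \<open>2 * s\<close> in each
  coordinate; hence the factor \<open>sqrt (2 * s)\<close>. Both laws have as characteristic
  function the expectation of this expression over \<open>s = S t\<close>.\<close>

lemma distr_subordination:
  fixes B :: "real \<Rightarrow> 'w \<Rightarrow> 'b::euclidean_space"
  assumes B: "brownian_motion M B" and S: "subordinator \<Psi> M S" and ind: "independent_processes M B S"
    and t: "0 \<le> t"
  shows "distr (completion M) borel (\<lambda>\<omega>. B (S t \<omega>) \<omega>)
    = distr (completion M \<Otimes>\<^sub>M std_gaussian) borel (\<lambda>(\<omega>, z). sqrt (2 * S t \<omega>) *\<^sub>R z)"
proof (rule char_eq_imp_measure_eq)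
  have M: "prob_space M" and S_meas: "S t \<in> borel_measurable M"
    using B S t by (auto simp: brownian_motion_def subordinator_def levy_process_def)
  interpret C: prob_space "completion M" by (intro prob_space_completion M)
  interpret G: prob_space "std_gaussian :: 'b measure" by (rule prob_space_std_gaussian)
  interpret P: pair_prob_space "completion M" "std_gaussian :: 'b measure" ..
  have [measurable]: "S t \<in> borel_measurable (completion M)"
    by (intro measurable_completion S_meas)
  note [measurable] = subordination_measurable[OF assms]
  let ?f = "\<lambda>(\<omega>, z :: 'b). sqrt (2 * S t \<omega>) *\<^sub>R z"
  show "prob_space (distr (completion M) borel (\<lambda>\<omega>. B (S t \<omega>) \<omega>))"
    by (intro C.prob_space_distr) measurable
  show "prob_space (distr (completion M \<Otimes>\<^sub>M std_gaussian) borel ?f)"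
    by (intro P.prob_space_distr) measurable
  fix \<xi> :: 'b
  have int: "integrable (completion M \<Otimes>\<^sub>M std_gaussian) (\<lambda>p. iexp (\<xi> \<bullet> ?f p))"
    by (rule P.integrable_const_bound[of _ 1]) auto
  have "(CLINT x|distr (completion M) borel (\<lambda>\<omega>. B (S t \<omega>) \<omega>). iexp (\<xi> \<bullet> x))
      = complex_of_real (LINT \<omega>|completion M. exp (- S t \<omega> * (norm \<xi>)\<^sup>2))"
    using subordination_char[OF assms] by (simp add: integral_distr)
  also have "\<dots> = (CLINT \<omega>|completion M. complex_of_real (exp (- S t \<omega> * (norm \<xi>)\<^sup>2)))"
    by (rule integral_complex_of_real[symmetric])
  also have "\<dots> = (CLINT \<omega>|completion M. CLINT z|std_gaussian. iexp ((sqrt (2 * S t \<omega>) *\<^sub>R \<xi>) \<bullet> z))"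
    unfolding std_gaussian_char
  \<comment> \<open>Squaring \<open>sqrt (2 * S t \<omega>)\<close> gives back
    \<open>2 * S t \<omega>\<close> only for nonnegative \<open>S t \<omega>\<close>, so the
    integrands agree almost everywhere.\<close>
  proof (rule integral_cong_AE)
    show "AE \<omega> in completion M. complex_of_real (exp (- S t \<omega> * (norm \<xi>)\<^sup>2))
        = complex_of_real (exp (- (norm (sqrt (2 * S t \<omega>) *\<^sub>R \<xi>))\<^sup>2 / 2))"
      using AE_completion[OF subordinator_nonneg[OF assms]]
      by eventually_elim (simp add: power_mult_distrib)
  qed measurable
  also have "\<dots> = (CLINT p|completion M \<Otimes>\<^sub>M std_gaussian. iexp (\<xi> \<bullet> ?f p))"
    using P.integral_fst'[OF int] by simp
  also have "\<dots> = (CLINT x|distr (completion M \<Otimes>\<^sub>M std_gaussian) borel ?f. iexp (\<xi> \<bullet> x))"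
    by (subst integral_distr) auto
  finally show "(CLINT x|distr (completion M) borel (\<lambda>\<omega>. B (S t \<omega>) \<omega>). iexp (\<xi> \<bullet> x))
    = (CLINT x|distr (completion M \<Otimes>\<^sub>M std_gaussian) borel ?f. iexp (\<xi> \<bullet> x))" .
qed auto

subsection \<open>The Liouville property\<close>

text \<open>After the change of variables, the difference is the integral of
  \<open>f (r *\<^sub>R v)\<close> against the difference of two Gaussian densities whose centres
  are \<open>(1 / r) *\<^sub>R x\<close> and 0. It is at most \<open>C\<close> times their L1
  distance, which tends to 0.\<close>

lemma tendsto_std_gaussian_shift:
  fixes f :: "'a::euclidean_space \<Rightarrow> real"
  assumes [measurable]: "f \<in> borel_measurable borel" and C: "\<And>x. \<bar>f x\<bar> \<le> C"
  shows "((\<lambda>r. (LINT z|std_gaussian. f (x + r *\<^sub>R z)) - (LINT z|std_gaussian. f (r *\<^sub>R z))) \<longlongrightarrow> 0) at_top"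
proof (rule tendsto_at_topI_sequentially)
  fix R :: "nat \<Rightarrow> real" assume R: "filterlim R at_top sequentially"
  have C0: "0 \<le> C" using C[of 0] by simp
  let ?g = "\<lambda>n v. std_gaussian_density (v - (1 / R n) *\<^sub>R x)"
  let ?d = "\<lambda>n v. ?g n v - std_gaussian_density v"
  have int0: "integrable lborel (std_gaussian_density :: 'a \<Rightarrow> real)"
    using integrable_std_gaussian_density[of 0] by simp
  have int: "integrable lborel (?d n)" for n
    by (intro Bochner_Integration.integrable_diff int0 integrable_std_gaussian_density)
  have "(\<lambda>n. 1 / R n) \<longlonglongrightarrow> 0"
    using R by (intro tendsto_divide_0[OF tendsto_const] filterlim_at_top_imp_at_infinity)
  then have "(\<lambda>n. v - (1 / R n) *\<^sub>R x) \<longlonglongrightarrow> v - 0 *\<^sub>R x" for v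
    by (intro tendsto_intros)
  then have pt: "(\<lambda>n. ?g n v) \<longlonglongrightarrow> std_gaussian_density v" for v
    using continuous_on_tendsto_compose[OF continuous_on_std_gaussian_density[of UNIV],
        of "\<lambda>n. v - (1 / R n) *\<^sub>R x" v sequentially] by simp
  \<comment> \<open>Scheffe's lemma upgrades pointwise convergence of densities to L1 convergence;
    its mass condition holds because every translate has integral 1.\<close>
  have "(\<lambda>n. \<integral>\<^sup>+v. norm (?d n v) \<partial>lborel) \<longlonglongrightarrow> 0"
  proof (rule Scheffe_lemma2)
    show "(\<integral>\<^sup>+v. norm (?g n v) \<partial>lborel) \<le> (\<integral>\<^sup>+v. norm (std_gaussian_density v) \<partial>(lborel :: 'a measure))" for n
      using nn_integral_std_gaussian_density[of "0 :: 'a"] by (simp add: nn_integral_std_gaussian_density)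
  qed (use int0 pt in auto)
  moreover have "(\<integral>\<^sup>+v. norm (?d n v) \<partial>lborel) = ennreal (LINT v|lborel. norm (?d n v))" for n
    by (intro nn_integral_eq_integral integrable_norm int) auto
  ultimately have L1: "(\<lambda>n. LINT v|lborel. norm (?d n v)) \<longlonglongrightarrow> 0"
    by (simp add: ennreal_tendsto_0_iff)
  \<comment> \<open>The change of variables divides by \<open>R n\<close>, which is guaranteed to be
    positive only from some index on.\<close>
  have "\<forall>\<^sub>F n in sequentially. norm ((LINT z|std_gaussian. f (x + R n *\<^sub>R z)) - (LINT z|std_gaussian. f (R n *\<^sub>R z)))
      \<le> C * (LINT v|lborel. norm (?d n v))"
    using R[unfolded filterlim_at_top_dense, rule_format, of 0]
  proof eventually_elim
    case (elim n)
    then have "R n \<noteq> 0" by simp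
    have fint: "integrable lborel (\<lambda>v. f (R n *\<^sub>R v) * std_gaussian_density (v - a))" for a
      by (rule Bochner_Integration.integrable_bound[OF integrable_mult_right[OF integrable_std_gaussian_density[of a], of C]])
         (use C C0 in \<open>auto simp: abs_mult intro!: mult_right_mono\<close>)
    have "(LINT z|std_gaussian. f (x + R n *\<^sub>R z)) - (LINT z|std_gaussian. f (R n *\<^sub>R z))
        = (LINT v|lborel. f (R n *\<^sub>R v) * ?g n v) - (LINT v|lborel. f (R n *\<^sub>R v) * std_gaussian_density v)"
      using integral_std_gaussian_shift[OF assms(1) \<open>R n \<noteq> 0\<close>, of x]
        integral_std_gaussian_shift[OF assms(1) \<open>R n \<noteq> 0\<close>, of 0] by simp
    also have "\<dots> = (LINT v|lborel. f (R n *\<^sub>R v) * ?d n v)"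
      using fint[of "(1 / R n) *\<^sub>R x"] fint[of 0]
      by (simp add: right_diff_distrib flip: Bochner_Integration.integral_diff)
    finally have eq: "(LINT z|std_gaussian. f (x + R n *\<^sub>R z)) - (LINT z|std_gaussian. f (R n *\<^sub>R z))
        = (LINT v|lborel. f (R n *\<^sub>R v) * ?d n v)" .
    have "\<bar>LINT v|lborel. f (R n *\<^sub>R v) * ?d n v\<bar> \<le> (LINT v|lborel. C * norm (?d n v))"
    proof (rule integral_abs_bound_integral)
      show "integrable lborel (\<lambda>v. f (R n *\<^sub>R v) * ?d n v)"
        using Bochner_Integration.integrable_diff[OF fint[of "(1 / R n) *\<^sub>R x"] fint[of 0]]
        by (simp add: right_diff_distrib)
      show "integrable lborel (\<lambda>v. C * norm (?d n v))"
        by (intro integrable_mult_right integrable_norm int)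
      show "\<bar>f (R n *\<^sub>R v) * ?d n v\<bar> \<le> C * norm (?d n v)" for v
        using C by (simp add: abs_mult mult_right_mono)
    qed
    then have "norm ((LINT z|std_gaussian. f (x + R n *\<^sub>R z)) - (LINT z|std_gaussian. f (R n *\<^sub>R z)))
        \<le> (LINT v|lborel. C * norm (?d n v))"
      unfolding eq by simp
    then show ?case by simp
  qed
  then show "(\<lambda>n. (LINT z|std_gaussian. f (x + R n *\<^sub>R z)) - (LINT z|std_gaussian. f (R n *\<^sub>R z))) \<longlonglongrightarrow> 0"
    using tendsto_mult_right_zero[OF L1, of C] by (rule Lim_null_comparison)
qed

text \<open>Conditioning on \<open>S t\<close> writes \<open>\<phi> x - \<phi> y\<close> as the
  expectation of \<open>D (sqrt (2 * S t \<omega>))\<close>, where \<open>D r\<close> compares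
  Gaussian averages of scale \<open>r\<close> around \<open>x\<close> and \<open>y\<close>.
  \<open>D\<close> is bounded and vanishes at infinity, while \<open>S t\<close> escapes to infinity
  as \<open>t\<close> grows; the left-hand side does not depend on \<open>t\<close>.\<close>

lemma bounded_invariant_const:
  fixes B :: "real \<Rightarrow> 'w \<Rightarrow> 'b::euclidean_space" and \<phi> :: "'b \<Rightarrow> real"
  assumes B: "brownian_motion M B" and S: "subordinator \<Psi> M S" and ind: "independent_processes M B S"
    and \<Psi>: "\<Psi> 1 > 0"
    and \<phi> [measurable]: "\<phi> \<in> borel_measurable borel" and C: "\<And>x. \<bar>\<phi> x\<bar> \<le> C"
    and inv: "\<And>t x. t > 0 \<Longrightarrow> \<phi> x = (LINT \<omega>|completion M. \<phi> (x + B (S t \<omega>) \<omega>))"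
  shows "\<phi> x = \<phi> y"
proof -
  have M: "prob_space M"
    using B by (auto simp: brownian_motion_def levy_process_def)
  interpret C: prob_space "completion M" by (intro prob_space_completion M)
  interpret G: prob_space "std_gaussian :: 'b measure" by (rule prob_space_std_gaussian)
  interpret P: pair_prob_space "completion M" "std_gaussian :: 'b measure" ..
  have C0: "0 \<le> C" using C[of 0] by simp
  define D where "D r = (LINT z|std_gaussian. \<phi> (x + r *\<^sub>R z)) - (LINT z|std_gaussian. \<phi> (y + r *\<^sub>R z))" for r
  have D_lim: "(D \<longlongrightarrow> 0) at_top"
    using tendsto_diff[OF tendsto_std_gaussian_shift[OF \<phi> C, of x] tendsto_std_gaussian_shift[OF \<phi> C, of y]]
    by (simp add: D_def[abs_def])
  have "\<bar>LINT z|std_gaussian. \<phi> (a + r *\<^sub>R z)\<bar> \<le> (LINT z|(std_gaussian :: 'b measure). C)" for a r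
    using C C0 by (intro integral_abs_bound_integral G.integrable_const_bound[of _ C]) auto
  then have G_bd: "\<bar>LINT z|std_gaussian. \<phi> (a + r *\<^sub>R z)\<bar> \<le> C" for a r
    using G.prob_space by simp
  then have D_bd: "\<bar>D r\<bar> \<le> 2 * C" for r
    using G_bd[of x r] G_bd[of y r] unfolding D_def by linarith
  have D_meas [measurable]: "D \<in> borel_measurable borel"
    unfolding D_def by measurable
  have S_meas [measurable]: "S t \<in> borel_measurable M" "S t \<in> borel_measurable (completion M)" if "t > 0" for t
    using S that by (auto simp: subordinator_def levy_process_def intro!: measurable_completion)
  have eq: "\<phi> x - \<phi> y = (LINT \<omega>|completion M. D (sqrt (2 * S t \<omega>)))" if "t > 0" for t
  proof -
    have t: "0 \<le> t" using that by simp
    note [measurable] = subordination_measurable[OF B S ind t] S_meas[OF that]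
    have fin: "integrable (completion M \<Otimes>\<^sub>M std_gaussian) (\<lambda>(\<omega>, z). \<phi> (a + sqrt (2 * S t \<omega>) *\<^sub>R z))" for a
      using C by (intro P.integrable_const_bound[of _ C]) auto
    have rep: "\<phi> a = (LINT \<omega>|completion M. LINT z|std_gaussian. \<phi> (a + sqrt (2 * S t \<omega>) *\<^sub>R z))" for a
    proof -
      have "\<phi> a = (LINT w|distr (completion M) borel (\<lambda>\<omega>. B (S t \<omega>) \<omega>). \<phi> (a + w))"
        using inv[OF that, of a] by (simp add: integral_distr)
      also have "\<dots> = (LINT p|(completion M \<Otimes>\<^sub>M std_gaussian). \<phi> (a + (case p of (\<omega>, z) \<Rightarrow> sqrt (2 * S t \<omega>) *\<^sub>R z)))"
        unfolding distr_subordination[OF B S ind t] by (subst integral_distr) auto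
      also have "\<dots> = (LINT \<omega>|completion M. LINT z|std_gaussian. \<phi> (a + sqrt (2 * S t \<omega>) *\<^sub>R z))"
        using P.integral_fst'[OF fin[of a]] by (simp add: case_prod_beta')
      finally show ?thesis .
    qed
    show ?thesis
      unfolding rep[of x] rep[of y] D_def
      using P.integrable_fst'[OF fin[of x]] P.integrable_fst'[OF fin[of y]]
      by (simp flip: Bochner_Integration.integral_diff)
  qed
  have bound: "\<bar>\<phi> x - \<phi> y\<bar> \<le> \<eta>" if "\<eta> > 0" for \<eta>
  proof -
    obtain K where K: "\<And>r. r \<ge> K \<Longrightarrow> \<bar>D r\<bar> < \<eta>"
      using tendstoD[OF D_lim \<open>\<eta> > 0\<close>] by (auto simp: eventually_at_top_linorder)
    define A where "A = 2 * C * exp (K\<^sup>2 / 2)"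
    have A: "0 \<le> A" using C0 by (simp add: A_def)
    \<comment> \<open>A Markov-type bound. Where \<open>sqrt (2 * s)\<close> is at least
      \<open>K\<close>, the term \<eta> suffices. Elsewhere \<open>s \<le> K\<^sup>2 / 2\<close>,
      and \<open>A\<close> is chosen so that \<open>A * exp (- s)\<close> is at least
      \<open>2 * C\<close>, the uniform bound on \<open>D\<close>. Integrating the exponential then
      brings in the Laplace transform of \<open>S t\<close> at 1.\<close>
    have pt: "\<bar>D (sqrt (2 * s))\<bar> \<le> \<eta> + A * exp (- 1 * s)" for s
    proof (cases "K \<le> sqrt (2 * s)")
      case True
      then show ?thesis using K[of "sqrt (2 * s)"] A by (smt (verit) exp_gt_zero mult_nonneg_nonneg)
    next
      case False
      have "s \<le> K\<^sup>2 / 2"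
      proof (cases "0 \<le> s")
        case True
        then have "(sqrt (2 * s))\<^sup>2 \<le> K\<^sup>2" using False by (intro power_mono) auto
        then show ?thesis using True by simp
      next
        case False
        then show ?thesis using zero_le_power2[of K] by linarith
      qed
      then have "1 \<le> exp (K\<^sup>2 / 2) * exp (- 1 * s)" by (simp flip: exp_add)
      then have "2 * C * 1 \<le> 2 * C * (exp (K\<^sup>2 / 2) * exp (- 1 * s))"
        using C0 by (intro mult_left_mono) auto
      then show ?thesis using D_bd[of "sqrt (2 * s)"] \<open>\<eta> > 0\<close> by (simp add: A_def mult.assoc)
    qed
    have le: "\<bar>\<phi> x - \<phi> y\<bar> \<le> \<eta> + A * exp (- t * \<Psi> 1)" if "t > 0" for t
    proof -
      note [measurable] = S_meas[OF that]
      have nn: "AE \<omega> in M. 0 \<le> S t \<omega>"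
        using subordinator_nonneg[OF B S ind] that by simp
      have iE: "integrable (completion M) (\<lambda>\<omega>. exp (- 1 * S t \<omega>))"
        using AE_completion[OF nn] by (intro C.integrable_const_bound[of _ 1]) auto
      have "(LINT \<omega>|completion M. exp (- 1 * S t \<omega>)) = (LINT \<omega>|M. exp (- 1 * S t \<omega>))"
        by (intro integral_completion) measurable
      also have "\<dots> = exp (- t * \<Psi> 1)"
      proof -
        have "\<forall>u>0. (LINT \<omega>|M. exp (- u * S t \<omega>)) = exp (- t * \<Psi> u)"
          using S less_imp_le[OF that] unfolding subordinator_def by blast
        then show ?thesis using zero_less_one by blast
      qed
      finally have E: "(LINT \<omega>|completion M. exp (- 1 * S t \<omega>)) = exp (- t * \<Psi> 1)" .
      have iD: "integrable (completion M) (\<lambda>\<omega>. D (sqrt (2 * S t \<omega>)))"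
        using D_bd by (intro C.integrable_const_bound[of _ "2 * C"]) auto
      have "\<bar>\<phi> x - \<phi> y\<bar> \<le> (LINT \<omega>|completion M. \<bar>D (sqrt (2 * S t \<omega>))\<bar>)"
        unfolding eq[OF that] by (rule integral_abs_bound)
      also have "\<dots> \<le> (LINT \<omega>|completion M. \<eta> + A * exp (- 1 * S t \<omega>))"
      proof (rule integral_mono)
        show "integrable (completion M) (\<lambda>\<omega>. \<bar>D (sqrt (2 * S t \<omega>))\<bar>)"
          using iD by (rule integrable_abs)
        show "integrable (completion M) (\<lambda>\<omega>. \<eta> + A * exp (- 1 * S t \<omega>))"
          using iE by (intro Bochner_Integration.integrable_add integrable_mult_right) auto
      qed (rule pt)
      also have "\<dots> = \<eta> + A * exp (- t * \<Psi> 1)"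
        using iE E C.prob_space by (simp add: Bochner_Integration.integral_add)
      finally show ?thesis .
    qed
    \<comment> \<open>Positivity of \<open>\<Psi> 1\<close> removes the exponential term as
      \<open>t\<close> tends to infinity, with \<eta> and hence \<open>A\<close> held fixed.\<close>
    have "((\<lambda>t. \<eta> + A * exp (- t * \<Psi> 1)) \<longlongrightarrow> \<eta> + A * 0) at_top"
    proof (intro tendsto_intros)
      have "filterlim (\<lambda>t. t * \<Psi> 1) at_top at_top"
        using \<Psi> by (rule filterlim_at_top_mult_tendsto_pos[OF tendsto_const _ filterlim_ident])
      then show "((\<lambda>t. exp (- t * \<Psi> 1)) \<longlongrightarrow> 0) at_top"
        by (auto intro!: filterlim_compose[OF exp_at_bot] simp: filterlim_uminus_at_bot)
    qed
    then have "\<bar>\<phi> x - \<phi> y\<bar> \<le> \<eta> + A * 0"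
      by (rule tendsto_lowerbound[OF _ eventually_mono[OF eventually_gt_at_top[of 0] le]]) simp_all
    then show ?thesis by simp
  qed
  have "\<bar>\<phi> x - \<phi> y\<bar> \<le> 0"
  proof (rule field_le_epsilon)
    fix e :: real assume "0 < e"
    from bound[OF this] show "\<bar>\<phi> x - \<phi> y\<bar> \<le> 0 + e" by simp
  qed
  then show ?thesis by simp
qed

theorem theorem5p1:
  fixes \<Psi> :: "real \<Rightarrow> real"
    and M :: "'w measure"
    and X :: "real \<Rightarrow> 'w \<Rightarrow> real ^ 'd"
  assumes "bernstein_class_0 \<Psi>"
    and "\<forall>u>0. \<Psi> u > 0"
    and "\<exists>\<mu> c. weak_lower_scaling \<Psi> \<mu> c 0"
    and "subordinate_brownian_motion \<Psi> M X"
  shows "\<forall>\<phi> :: real ^ 'd \<Rightarrow> real. bounded (range \<phi>) \<and> process_harmonic M X \<phi> \<longrightarrow> \<phi> constant_on UNIV"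
proof (intro allI impI; elim conjE)
  fix \<phi> :: "real ^ 'd \<Rightarrow> real"
  assume bdd: "bounded (range \<phi>)" and harm: "process_harmonic M X \<phi>"
  obtain C where C: "\<And>x. \<bar>\<phi> x\<bar> \<le> C"
    using bdd by (auto simp: bounded_iff)
  obtain B S where BS: "brownian_motion M B" "subordinator \<Psi> M S" "independent_processes M B S"
    and X: "X = (\<lambda>t \<omega>. B (S t \<omega>) \<omega>)"
    using assms(4) by (auto simp: subordinate_brownian_motion_def)
  have M: "prob_space M"
    using BS by (auto simp: brownian_motion_def levy_process_def)
  have "\<phi> x = \<phi> y" for x y
  proof (rule bounded_invariant_const[OF BS _ _ C])
    show "\<phi> \<in> borel_measurable borel"
      using harm by (simp add: process_harmonic_def)
    show "\<phi> x = (LINT \<omega>|completion M. \<phi> (x + B (S t \<omega>) \<omega>))" if "t > 0" for t x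
      \<comment> \<open>Removing the stopping requires \<open>X t\<close> to be measurable for the
        completion and paths to be almost surely bounded on \<open>{0..t}\<close>; subordination
        provides both.\<close>
      using process_harmonic_mean_value[OF M harm C that, of x]
        subordination_measurable[OF BS, of t] subordination_bounded[OF BS, of t] that
      by (simp add: X)
  qed (use assms(2) in auto)
  then show "\<phi> constant_on UNIV"
    by (auto simp: constant_on_def)
qed

end
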